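(* Let $\Re(\gamma)>\Re(\alpha)>0$, $\min\{\Re(b),\Re(d)\}\ge0$ and $\max\{|\arg(1-x)|,|\arg(1-y)|\}<\pi$. Then the extended Appell function satisfies $$ \mathbf{F}_{1}^{(\kappa_l)}(\alpha,\beta,\beta';\gamma;x,y;b,d)=(1-x)^{-\beta}(1-y)^{-\beta'}\,\mathbf{F}_{1}^{(\kappa_l)}\left(\gamma-\alpha,\beta,\beta';\gamma;\frac{x}{x-1},\frac{y}{y-1};d,b\right). $$
   Context: Here $(a)_m=\Gamma(a+m)/\Gamma(a)$ is the Pochhammer symbol and $B(\cdot,\cdot)$ is Euler's beta function; powers are principal. Let $\{\kappa_l\}_{l\ge0}$ be a complex sequence with $\kappa_0=1$ and let $\Theta(z)=\Theta(\kappa_l;z)$ be a function analytic in a disk $|z|<R$ ($0<R<\infty$) with $\Theta(z)=\sum_{l\ge0}\kappa_l z^l/l!$ there, continued analytically to the half-plane $\Re(z)>0$ with $\Theta(z)=M_0z^{\omega}e^{z}[1+O(1/z)]$ as $\Re(z)\to\infty$ ($M_0>0$, $\omega\in\mathbb{C}$). It is also understood that $\Theta$ is defined and continuous on $\Re(z)\le 0$ and that the following integrals converge absolutely. For $\Re(b),\Re(d)\ge0$ and $\Re(\alpha),\Re(\beta)>0$, $$\mathcal{B}^{(\kappa_l)}_{b,d}(\alpha,\beta)=\int_0^1t^{\alpha-1}(1-t)^{\beta-1}\Theta\left(-\frac bt-\frac d{1-t}\right)dt .$$ The extended Appell function $\mathbf{F}_1^{(\kappa_l)}$ is, for $\max\{|x|,|y|\}<1$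 and $\Re(\gamma_1)>\Re(\alpha)>0$, $$\mathbf{F}_{1}^{(\kappa_l)}(\alpha,\beta_1,\beta_2;\gamma_1;x,y;b,d)=\sum_{m,n=0}^\infty(\beta_1)_m(\beta_2)_n\frac{\mathcal{B}^{(\kappa_l)}_{b,d}(\alpha+m+n,\gamma_1-\alpha)}{B(\alpha,\gamma_1-\alpha)}\frac{x^my^n}{m!\,n!},$$ and for $\max\{|\arg(1-x)|,|\arg(1-y)|\}<\pi$ it is given by its integral representation $$\frac1{B(\alpha,\gamma_1-\alpha)}\int_0^1t^{\alpha-1}(1-t)^{\gamma_1-\alpha-1}(1-xt)^{-\beta_1}(1-yt)^{-\beta_2}\Theta\left(-\frac bt-\frac d{1-t}\right)dt .$$ *)

theory Defs
  imports "HOL-Analysis.Analysis" "HOL-Library.Landau_Symbols"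
begin

text \<open>
  On the part of \<open>Re z \<le> 0\<close> outside the disk, \<open>\<Theta>\<close> is not determined by \<open>\<kappa>\<close>. The functions below
  therefore take \<open>\<Theta>\<close> itself as a parameter, and this predicate ties it to \<open>\<kappa>\<close>.
  \<open>filtercomap Re at_top\<close> is the filter ``\<open>Re z \<rightarrow> \<infinity>\<close>'', uniformly in \<open>Im z\<close>.
\<close>

definition admissible_Theta ::
    "(nat \<Rightarrow> complex) \<Rightarrow> real \<Rightarrow> real \<Rightarrow> complex \<Rightarrow> (complex \<Rightarrow> complex) \<Rightarrow> bool" where
  "admissible_Theta \<kappa> R M0 \<omega> \<Theta> \<longleftrightarrow>
     \<kappa> 0 = 1 \<and> 0 < R \<and> 0 < M0 \<and>
     \<Theta> analytic_on (ball 0 R \<union> {z. Re z > 0}) \<and>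
     (\<forall>z\<in>ball 0 R. (\<lambda>l. \<kappa> l * z ^ l / fact l) sums \<Theta> z) \<and>
     (\<lambda>z. \<Theta> z / (of_real M0 * z powr \<omega> * exp z) - 1) \<in> O[filtercomap Re at_top](\<lambda>z. 1 / z) \<and>
     continuous_on {z. Re z \<le> 0} \<Theta>"

definition ext_beta_integrand ::
    "(complex \<Rightarrow> complex) \<Rightarrow> complex \<Rightarrow> complex \<Rightarrow> complex \<Rightarrow> complex \<Rightarrow> real \<Rightarrow> complex" where
  "ext_beta_integrand \<Theta> b d \<alpha> \<beta> t =
     of_real t powr (\<alpha> - 1) * (1 - of_real t) powr (\<beta> - 1)
       * \<Theta> (- b / of_real t - d / (1 - of_real t))"

definition ext_Beta ::
    "(complex \<Rightarrow> complex) \<Rightarrow> complex \<Rightarrow> complex \<Rightarrow> complex \<Rightarrow> complex \<Rightarrow> complex" where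
  "ext_Beta \<Theta> b d \<alpha> \<beta> = (LINT t:{0<..<1}|lborel. ext_beta_integrand \<Theta> b d \<alpha> \<beta> t)"

definition ext_Appell_F1_series ::
    "(complex \<Rightarrow> complex) \<Rightarrow> complex \<Rightarrow> complex \<Rightarrow> complex \<Rightarrow> complex \<Rightarrow>
     complex \<Rightarrow> complex \<Rightarrow> complex \<Rightarrow> complex \<Rightarrow> complex" where
  "ext_Appell_F1_series \<Theta> \<alpha> \<beta>1 \<beta>2 \<gamma>1 x y b d =
     (\<Sum>\<^sub>\<infinity>(m, n)\<in>UNIV. pochhammer \<beta>1 m * pochhammer \<beta>2 n
        * (ext_Beta \<Theta> b d (\<alpha> + of_nat m + of_nat n) (\<gamma>1 - \<alpha>) / Beta \<alpha> (\<gamma>1 - \<alpha>))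
        * (x ^ m * y ^ n / (fact m * fact n)))"

definition ext_Appell_F1_integral ::
    "(complex \<Rightarrow> complex) \<Rightarrow> complex \<Rightarrow> complex \<Rightarrow> complex \<Rightarrow> complex \<Rightarrow>
     complex \<Rightarrow> complex \<Rightarrow> complex \<Rightarrow> complex \<Rightarrow> complex" where
  "ext_Appell_F1_integral \<Theta> \<alpha> \<beta>1 \<beta>2 \<gamma>1 x y b d =
     1 / Beta \<alpha> (\<gamma>1 - \<alpha>) *
     (LINT t:{0<..<1}|lborel.
        of_real t powr (\<alpha> - 1) * (1 - of_real t) powr (\<gamma>1 - \<alpha> - 1)
        * (1 - x * of_real t) powr (- \<beta>1) * (1 - y * of_real t) powr (- \<beta>2)
        * \<Theta> (- b / of_real t - d / (1 - of_real t)))"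

text \<open>
  The double series is the definition where it converges; elsewhere on the cut domain
  \<open>\<bar>arg (1 - x)\<bar>, \<bar>arg (1 - y)\<bar> < \<pi>\<close> the function is given by the integral representation.
  That the two agree on the polydisk is not built into the definition.
\<close>

definition ext_Appell_F1 ::
    "(complex \<Rightarrow> complex) \<Rightarrow> complex \<Rightarrow> complex \<Rightarrow> complex \<Rightarrow> complex \<Rightarrow>
     complex \<Rightarrow> complex \<Rightarrow> complex \<Rightarrow> complex \<Rightarrow> complex" where
  "ext_Appell_F1 \<Theta> \<alpha> \<beta>1 \<beta>2 \<gamma>1 x y b d =
     (if max (norm x) (norm y) < 1 then ext_Appell_F1_series \<Theta> \<alpha> \<beta>1 \<beta>2 \<gamma>1 x y b d
      else ext_Appell_F1_integral \<Theta> \<alpha> \<beta>1 \<beta>2 \<gamma>1 x y b d)"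

end

theory Submission
  imports Defs
begin

text \<open>
  Expanding both binomial factors and integrating termwise, which the integrability of the beta
  integrand justifies since \<open>0 < t < 1\<close>, identifies the double series with the integral
  representation. In the integral, substitute \<open>t \<mapsto> 1 - t\<close> and use
  \<open>1 - x (1 - t) = (1 - x) (1 - x t / (x - 1))\<close>. The two factors on the right have imaginary parts of
  opposite sign or are both positive, so the principal power is multiplicative on them.
\<close>

section \<open>Termwise integration of double power series\<close>

lemma has_sum_product_abs_summable:
  fixes f :: "'a \<Rightarrow> complex" and g :: "'b \<Rightarrow> complex"
  assumes f: "(\<lambda>i. norm (f i)) summable_on A" and g: "(\<lambda>j. norm (g j)) summable_on B"
  shows "(\<lambda>p. norm (case p of (i, j) \<Rightarrow> f i * g j)) summable_on A \<times> B"
    and "((\<lambda>(i, j). f i * g j) has_sum (infsum f A * infsum g B)) (A \<times> B)"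
proof -
  show abs: "(\<lambda>p. norm (case p of (i, j) \<Rightarrow> f i * g j)) summable_on A \<times> B"
    unfolding Infinite_Sum.abs_summable_on_Sigma_iff
    using f g by (auto simp: norm_mult infsum_cmult_right' infsum_nonneg abs_mult
      intro!: summable_on_cmult_right summable_on_cmult_left)
  then have sm: "(\<lambda>(i, j). f i * g j) summable_on A \<times> B"
    by (rule abs_summable_summable)
  have "infsum (\<lambda>(i, j). f i * g j) (A \<times> B) = (\<Sum>\<^sub>\<infinity>i\<in>A. \<Sum>\<^sub>\<infinity>j\<in>B. f i * g j)"
    using infsum_Sigma'_banach[OF sm] by simp
  also have "\<dots> = infsum f A * infsum g B"
    by (simp add: infsum_cmult_right' infsum_cmult_left')
  finally show "((\<lambda>(i, j). f i * g j) has_sum (infsum f A * infsum g B)) (A \<times> B)"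
    using sm by (metis has_sum_infsum)
qed

text \<open>Since \<open>t ^ (m + n)\<close> is at most 1 on the unit interval, the term of index
  \<open>(m, n)\<close> is dominated by \<open>norm (a m) * norm (b n) * norm (w t)\<close>. The
  integrals of these bounds are summable, so sum and integral may be exchanged.\<close>

lemma has_sum_set_integral_double_power_series:
  fixes a b :: "nat \<Rightarrow> complex" and w :: "real \<Rightarrow> complex"
  assumes a: "summable (\<lambda>n. norm (a n))" and b: "summable (\<lambda>n. norm (b n))"
    and w: "set_integrable lborel {0<..<1} w"
    and A: "\<And>t. t \<in> {0<..<1} \<Longrightarrow> (\<lambda>n. a n * of_real t ^ n) sums A t"
    and B: "\<And>t. t \<in> {0<..<1} \<Longrightarrow> (\<lambda>n. b n * of_real t ^ n) sums B t"
  shows "((\<lambda>(m, n). a m * b n * (LINT t:{0<..<1}|lborel. w t * of_real t ^ (m + n)))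
            has_sum (LINT t:{0<..<1}|lborel. w t * (A t * B t))) UNIV"
proof -
  \<comment> \<open>Extending \<open>w\<close> by zero makes the domination of \<open>g p\<close> by
    \<open>norm (c p) * norm (W t)\<close> hold for every real \<open>t\<close>.\<close>
  define W where "W t = indicator {0<..<1} t *\<^sub>R w t" for t :: real
  have W: "integrable lborel W"
    using w unfolding set_integrable_def W_def .
  define c where "c = (\<lambda>(m, n). a m * b n)"
  define g where "g p t = c p * (W t * of_real t ^ (fst p + snd p))" for p t
  have abs: "(\<lambda>n. norm (a n)) summable_on UNIV" "(\<lambda>n. norm (b n)) summable_on UNIV"
    using a b by (simp_all add: norm_summable_imp_summable_on)
  have cabs: "(\<lambda>p. norm (c p)) summable_on UNIV"
    using has_sum_product_abs_summable(1)[OF abs] by (simp add: c_def)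
  \<comment> \<open>Enumerating the pairs by \<open>prod_decode\<close> turns the double series into
    a sequence, to which \<open>sums_integral\<close> applies.\<close>
  have bij: "bij_betw prod_decode UNIV UNIV"
    by (simp add: bij_prod_decode)
  have csum: "summable (\<lambda>i. norm (c (prod_decode i)))"
    using cabs summable_on_reindex_bij_betw[OF bij, of "\<lambda>p. norm (c p)"]
    by (simp add: summable_on_UNIV_nonneg_real_iff)
  have bound: "norm (g p t) \<le> norm (c p) * norm (W t)" for p t
    unfolding g_def W_def
    by (auto simp: norm_mult norm_power indicator_def power_le_one
        intro!: mult_left_mono mult_left_le)
  have gint: "integrable lborel (g p)" for p
  proof (rule Bochner_Integration.integrable_bound)
    show "integrable lborel (\<lambda>t. c p * W t)"
      using W by simp
    show "g p \<in> borel_measurable lborel"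
      using borel_measurable_integrable[OF W] unfolding g_def by measurable
  qed (use bound in \<open>auto simp: norm_mult\<close>)
  have gabs: "summable (\<lambda>i. norm (g (prod_decode i) t))" for t
    by (rule summable_comparison_test'[OF summable_mult2[OF csum, of "norm (W t)"]])
       (use bound in auto)
  have gnorm: "norm (LINT t|lborel. norm (g p t)) \<le> norm (c p) * (LINT t|lborel. norm (W t))" for p
  proof -
    have "(LINT t|lborel. norm (g p t)) \<le> (LINT t|lborel. norm (c p) * norm (W t))"
      by (rule integral_mono) (use gint W bound in auto)
    then show ?thesis by simp
  qed
  have gnsum: "summable (\<lambda>i. LINT t|lborel. norm (g (prod_decode i) t))"
    by (rule summable_comparison_test'[OF
          summable_mult2[OF csum, of "LINT t|lborel. norm (W t)"]])
       (use gnorm in auto)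
  have sums: "(\<lambda>i. LINT t|lborel. g (prod_decode i) t) sums
      (LINT t|lborel. (\<Sum>i. g (prod_decode i) t))"
    by (rule sums_integral) (use gint gabs gnsum in auto)
  \<comment> \<open>Absolute convergence upgrades the sum in the order of the enumeration to an
    unordered one, which can be reindexed back to pairs.\<close>
  have "summable (\<lambda>i. norm (LINT t|lborel. g (prod_decode i) t))"
    by (rule summable_comparison_test'[OF gnsum]) simp
  from norm_summable_imp_has_sum[OF this sums]
  have main: "((\<lambda>p. LINT t|lborel. g p t) has_sum (LINT t|lborel. (\<Sum>i. g (prod_decode i) t))) UNIV"
    using has_sum_reindex_bij_betw[OF bij, of "\<lambda>p. LINT t|lborel. g p t"] by simp
  \<comment> \<open>Inside the interval the enumerated sum is an unordered sum over pairs and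
    factors into the two power series. Outside, \<open>W\<close> vanishes and both sides are
    0.\<close>
  have pointwise: "(\<Sum>i. g (prod_decode i) t) = indicator {0<..<1} t *\<^sub>R (w t * (A t * B t))" for t
  proof (cases "t \<in> {0<..<1}")
    case t: True
    have pa: "summable (\<lambda>n. norm (a n * of_real t ^ n))"
      by (rule summable_comparison_test'[OF a])
         (use t in \<open>auto simp: norm_mult norm_power power_le_one intro!: mult_left_le\<close>)
    have pb: "summable (\<lambda>n. norm (b n * of_real t ^ n))"
      by (rule summable_comparison_test'[OF b])
         (use t in \<open>auto simp: norm_mult norm_power power_le_one intro!: mult_left_le\<close>)
    have ia: "infsum (\<lambda>n. a n * of_real t ^ n) UNIV = A t"
      using norm_summable_imp_has_sum[OF pa A[OF t]] by (rule infsumI)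
    have ib: "infsum (\<lambda>n. b n * of_real t ^ n) UNIV = B t"
      using norm_summable_imp_has_sum[OF pb B[OF t]] by (rule infsumI)
    have "((\<lambda>(m, n). (a m * of_real t ^ m) * (b n * of_real t ^ n)) has_sum (A t * B t)) UNIV"
      using has_sum_product_abs_summable(2)[OF norm_summable_imp_summable_on
          norm_summable_imp_summable_on, of "\<lambda>n. a n * of_real t ^ n" "\<lambda>n. b n * of_real t ^ n"]
        pa pb by (simp add: ia ib)
    from has_sum_cmult_right[OF this, of "W t"]
    have "((\<lambda>p. g p t) has_sum (W t * (A t * B t))) UNIV"
      by (rule has_sum_cong[THEN iffD1, rotated])
         (auto simp: g_def c_def power_add algebra_simps)
    then have "((\<lambda>i. g (prod_decode i) t) has_sum (W t * (A t * B t))) UNIV"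
      using has_sum_reindex_bij_betw[OF bij, of "\<lambda>p. g p t"] by simp
    from sums_unique[OF has_sum_imp_sums[OF this]] show ?thesis
      using t by (simp add: W_def)
  qed (simp add: g_def W_def)
  have termwise: "(LINT t|lborel. g (m, n) t) =
      a m * b n * (LINT t:{0<..<1}|lborel. w t * of_real t ^ (m + n))" for m n
  proof -
    have "(LINT t|lborel. g (m, n) t) =
        (LINT t:{0<..<1}|lborel. (a m * b n) * (w t * of_real t ^ (m + n)))"
      unfolding set_lebesgue_integral_def
      by (rule Bochner_Integration.integral_cong) (simp_all add: g_def c_def W_def)
    then show ?thesis
      by (simp only: set_integral_mult_right)
  qed
  show ?thesis
    using main unfolding pointwise set_lebesgue_integral_def[symmetric]
    by (rule has_sum_cong[THEN iffD1, rotated]) (auto simp: termwise)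
qed

section \<open>The binomial series in Pochhammer form\<close>

lemma binomial_pochhammer_sums:
  fixes z :: complex
  assumes "norm z < 1"
  shows "(\<lambda>n. pochhammer s n / fact n * z ^ n) sums (1 - z) powr (- s)"
proof -
  have "(\<lambda>n. ((- s) gchoose n) * (- z) ^ n) sums (1 + - z) powr (- s)"
    by (rule gen_binomial_complex) (use assms in simp)
  \<comment> \<open>Writing the binomial coefficient of \<open>- s\<close> through
    \<open>pochhammer s n\<close> costs a sign \<open>(-1) ^ n\<close>, which cancels the one from
    \<open>(- z) ^ n\<close>.\<close>
  moreover have "((- s) gchoose n) * (- z) ^ n = pochhammer s n / fact n * z ^ n" for n
  proof -
    have "((-1) ^ n * (-1) ^ n :: complex) = 1"
      by (simp flip: power_mult_distrib)
    moreover have "(- z) ^ n = (-1) ^ n * z ^ n"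
      by (rule power_minus)
    ultimately show ?thesis
      by (simp add: gbinomial_pochhammer)
  qed
  ultimately show ?thesis by simp
qed

text \<open>The series converges at some real \<open>r\<close> strictly between
  \<open>norm z\<close> and 1, and a power series converges absolutely at every point of smaller
  modulus.\<close>

lemma binomial_pochhammer_summable_norm:
  fixes z :: complex
  assumes "norm z < 1"
  shows "summable (\<lambda>n. norm (pochhammer s n / fact n * z ^ n))"
proof -
  obtain r where r: "norm z < r" "r < 1" using assms dense by blast
  then have "norm (of_real r :: complex) < 1"
    using le_less_trans[OF norm_ge_zero r(1)] by simp
  from sums_summable[OF binomial_pochhammer_sums[OF this]] show ?thesis
    by (rule powser_insidea) (use r le_less_trans[OF norm_ge_zero r(1)] in simp)
qed

text \<open>Raising the first beta parameter by \<open>m + n\<close> multiplies the integrand by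
  \<open>t ^ (m + n)\<close>. All the extended beta values in the series are therefore moments of
  one weight, the integrand at \<alpha>, and termwise integration against the two binomial series
  applies.\<close>

lemma ext_Appell_F1_series_eq_integral:
  assumes w: "set_integrable lborel {0<..<1} (ext_beta_integrand \<Theta> b d \<alpha> (\<gamma> - \<alpha>))"
    and x: "norm x < 1" and y: "norm y < 1"
  shows "ext_Appell_F1_series \<Theta> \<alpha> \<beta> \<beta>' \<gamma> x y b d = ext_Appell_F1_integral \<Theta> \<alpha> \<beta> \<beta>' \<gamma> x y b d"
proof -
  let ?w = "ext_beta_integrand \<Theta> b d \<alpha> (\<gamma> - \<alpha>)"
  let ?a = "\<lambda>m. pochhammer \<beta> m / fact m * x ^ m" and ?b = "\<lambda>n. pochhammer \<beta>' n / fact n * y ^ n"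
  have expand: "(\<lambda>n. pochhammer s n / fact n * z ^ n * of_real t ^ n) sums
      (1 - z * of_real t) powr (- s)" if "norm z < 1" "t \<in> {0<..<1}" for s z :: complex and t :: real
  proof -
    have "norm (z * of_real t) \<le> norm z"
      using that by (auto simp: norm_mult intro!: mult_left_le)
    with that have "norm (z * of_real t) < 1" by simp
    from binomial_pochhammer_sums[OF this, of s] show ?thesis
      by (simp add: power_mult_distrib mult.assoc)
  qed
  have beta: "ext_Beta \<Theta> b d (\<alpha> + of_nat m + of_nat n) (\<gamma> - \<alpha>) =
      (LINT t:{0<..<1}|lborel. ?w t * of_real t ^ (m + n))" for m n
    unfolding ext_Beta_def
  proof (rule set_lebesgue_integral_cong)
    show "\<forall>t. t \<in> {0<..<1} \<longrightarrow>
        ext_beta_integrand \<Theta> b d (\<alpha> + of_nat m + of_nat n) (\<gamma> - \<alpha>) t = ?w t * of_real t ^ (m + n)"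
    proof (intro allI impI)
      fix t :: real assume "t \<in> {0<..<1}"
      then have "complex_of_real t powr (\<alpha> + of_nat m + of_nat n - 1) =
          of_real t powr (\<alpha> - 1) * of_real t ^ (m + n)"
        using powr_add[of "complex_of_real t" "\<alpha> - 1" "of_nat (m + n)"]
          powr_nat'[of "complex_of_real t" "m+n"]
        by (simp add: algebra_simps)
      then show "ext_beta_integrand \<Theta> b d (\<alpha> + of_nat m + of_nat n) (\<gamma> - \<alpha>) t = ?w t * of_real t ^ (m + n)"
        by (simp add: ext_beta_integrand_def)
    qed
  qed simp
  have "((\<lambda>(m, n). ?a m * ?b n * (LINT t:{0<..<1}|lborel. ?w t * of_real t ^ (m + n))) has_sum
      (LINT t:{0<..<1}|lborel. ?w t * ((1 - x * of_real t) powr (- \<beta>) * (1 - y * of_real t) powr (- \<beta>')))) UNIV"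
    by (rule has_sum_set_integral_double_power_series
        [OF binomial_pochhammer_summable_norm binomial_pochhammer_summable_norm w])
       (use x y expand in auto)
  from has_sum_cmult_right[OF this, of "1 / Beta \<alpha> (\<gamma> - \<alpha>)"]
  have "((\<lambda>(m, n). pochhammer \<beta> m * pochhammer \<beta>' n
        * (ext_Beta \<Theta> b d (\<alpha> + of_nat m + of_nat n) (\<gamma> - \<alpha>) / Beta \<alpha> (\<gamma> - \<alpha>))
        * (x ^ m * y ^ n / (fact m * fact n))) has_sum
      1 / Beta \<alpha> (\<gamma> - \<alpha>) * (LINT t:{0<..<1}|lborel. ?w t *
        ((1 - x * of_real t) powr (- \<beta>) * (1 - y * of_real t) powr (- \<beta>')))) UNIV"
    by (rule has_sum_cong[THEN iffD1, rotated]) (simp only: split_paired_all prod.case beta, simp)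
  then show ?thesis
    unfolding ext_Appell_F1_series_def ext_Appell_F1_integral_def ext_beta_integrand_def
    by (subst infsumI, assumption) (simp add: mult_ac)
qed

text \<open>The map from \<open>x\<close> to \<open>x / (x - 1)\<close> does not preserve the unit
  disk, so the two sides of the transformation may fall into different branches of
  \<open>ext_Appell_F1\<close>. This agreement of the branches reduces everything to the integral
  representation.\<close>

lemma ext_Appell_F1_eq_integral:
  assumes "set_integrable lborel {0<..<1} (ext_beta_integrand \<Theta> b d \<alpha> (\<gamma> - \<alpha>))"
  shows "ext_Appell_F1 \<Theta> \<alpha> \<beta> \<beta>' \<gamma> x y b d = ext_Appell_F1_integral \<Theta> \<alpha> \<beta> \<beta>' \<gamma> x y b d"
  using ext_Appell_F1_series_eq_integral[OF assms] by (simp add: ext_Appell_F1_def)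

section \<open>Reflection of the unit interval\<close>

lemma set_integral_reflect_unit_interval:
  fixes f :: "real \<Rightarrow> 'a :: {banach, second_countable_topology}"
  shows "(LINT t:{0<..<1}|lborel. f t) = (LINT t:{0<..<1}|lborel. f (1 - t))"
proof -
  have "indicator {0<..<1} (1 - t) = (indicator {0<..<1} t :: real)" for t :: real
    by (auto simp: indicator_def)
  \<comment> \<open>This is the affine substitution with slope -1 and offset 1. A function that is
    not integrable has integral 0 by convention, and so has its reflection, so the identity is
    unconditional.\<close>
  then show ?thesis
    unfolding set_lebesgue_integral_def
    using lborel_integral_real_affine[of "-1" "\<lambda>t. indicator {0<..<1} t *\<^sub>R f t" 1] by simp
qed

lemma ext_beta_integrand_reflect:
  "ext_beta_integrand \<Theta> b d \<alpha> \<beta> (1 - t) = ext_beta_integrand \<Theta> d b \<beta> \<alpha> t"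
  unfolding ext_beta_integrand_def by (simp add: mult_ac minus_diff_commute)

text \<open>Transfers the integrability assumed for the left-hand side of the transformation to the
  function on its right-hand side.\<close>

lemma set_integrable_ext_beta_integrand_swap:
  assumes "set_integrable lborel {0<..<1} (ext_beta_integrand \<Theta> b d \<alpha> \<beta>)"
  shows "set_integrable lborel {0<..<1} (ext_beta_integrand \<Theta> d b \<beta> \<alpha>)"
proof -
  have "indicator {0<..<1} (1 - t) = (indicator {0<..<1} t :: real)" for t :: real
    by (auto simp: indicator_def)
  then show ?thesis
    using lborel_integrable_real_affine[OF assms[unfolded set_integrable_def], of "-1" 1]
    by (simp add: set_integrable_def ext_beta_integrand_reflect)
qed

section \<open>Multiplicativity of principal powers\<close>

lemma powr_mult_Im_opposite:
  fixes u v :: complex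
  assumes nz: "u \<noteq> 0" "v \<noteq> 0"
    and "0 < Im u \<and> Im v < 0 \<or> Im u < 0 \<and> 0 < Im v \<or> Im u = 0 \<and> 0 < Re u"
  shows "(u * v) powr s = u powr s * v powr s"
proof -
  \<comment> \<open>Principal logarithms add when the sum of the arguments stays in the range from
    \<open>- pi\<close> (excluded) to \<open>pi\<close>. Opposite signs of the imaginary parts put
    one argument between 0 and \<open>pi\<close> and the other between \<open>- pi\<close> and 0.
    For \<open>u\<close> positive real its argument is 0, so \<open>v\<close> alone decides.\<close>
  have "- pi < Im (Ln u + Ln v) \<and> Im (Ln u + Ln v) \<le> pi"
    using assms Im_Ln_pos_lt[OF nz(1)] Im_Ln_pos_lt[OF nz(2)] Im_Ln_eq_0[OF nz(1)]
      Im_Ln_pos_le[OF nz(1)] Im_Ln_pos_le[OF nz(2)]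
      mpi_less_Im_Ln[OF nz(1)] mpi_less_Im_Ln[OF nz(2)] Im_Ln_le_pi[OF nz(1)] Im_Ln_le_pi[OF nz(2)]
    unfolding plus_complex.simps by argo
  then have "Ln (u * v) = Ln u + Ln v"
    by (simp add: Ln_times nz)
  then show ?thesis
    by (simp add: powr_def nz exp_add algebra_simps)
qed

text \<open>With \<open>u = 1 - x\<close>, the second factor \<open>v\<close> equals
  \<open>(1 - t) + t / u\<close>, a convex combination of 1 and the inverse of \<open>u\<close>.
  Inversion flips the sign of the imaginary part and keeps positive reals positive. The condition
  \<open>x \<noteq> 1\<close> is stated separately because \<open>Arg 0\<close> is 0 and passes the
  bound on the argument.\<close>

lemma powr_reflect_factor:
  fixes x :: complex and t :: real
  assumes x: "x \<noteq> 1" "\<bar>Arg (1 - x)\<bar> < pi" and t: "t \<in> {0<..<1}"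
  shows "(1 - x * (1 - of_real t)) powr s = (1 - x) powr s * (1 - x / (x - 1) * of_real t) powr s"
proof -
  define u where "u = 1 - x"
  define v where "v = 1 - x / (x - 1) * of_real t"
  have u: "u \<noteq> 0" "Im u \<noteq> 0 \<or> 0 < Re u"
  proof -
    show "u \<noteq> 0" using x by (simp add: u_def)
    \<comment> \<open>The argument is \<open>pi\<close> exactly on the negative real axis, so the
      strict bound says that \<open>u\<close> lies off the branch cut.\<close>
    moreover have "\<not> (Re u < 0 \<and> Im u = 0)"
      using x(2) Arg_eq_pi[of u] by (auto simp: u_def)
    ultimately show "Im u \<noteq> 0 \<or> 0 < Re u" by (auto simp: complex_eq_iff)
  qed
  have v: "v = of_real (1 - t) + of_real t * inverse u"
    using x(1) by (simp add: v_def u_def field_simps)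
  have Imv: "Im v = - (t * Im u / ((Re u)\<^sup>2 + (Im u)\<^sup>2))"
    by (simp add: v)
  have pos: "(Re u)\<^sup>2 + (Im u)\<^sup>2 > 0"
    using u(1) by (simp add: complex_eq_iff sum_power2_gt_zero_iff)
  have Rev: "Re v = 1 - t + t * Re u / ((Re u)\<^sup>2 + (Im u)\<^sup>2)"
    by (simp add: v)
  have sgn: "0 < Im u \<Longrightarrow> Im v < 0" "Im u < 0 \<Longrightarrow> 0 < Im v"
    using pos t by (auto simp: Imv divide_neg_pos mult_pos_neg)
  have "v \<noteq> 0"
  proof (cases "Im u = 0")
    case True
    with u have "0 < Re v"
      using t pos unfolding Rev by (intro add_pos_nonneg) auto
    then show ?thesis by auto
  next
    case False
    then show ?thesis using sgn by (metis linorder_neqE_linordered_idom order_less_irrefl zero_complex.simps(2))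
  qed
  then have "(u * v) powr s = u powr s * v powr s"
    using u sgn by (intro powr_mult_Im_opposite) force+
  moreover have "u * v = 1 - x * (1 - of_real t)"
    using u(1) by (simp add: v u_def field_simps)
  ultimately show ?thesis by (simp add: u_def v_def)
qed

section \<open>The transformation formula\<close>

lemma ext_Appell_F1_integral_transform:
  assumes x: "x \<noteq> 1" "\<bar>Arg (1 - x)\<bar> < pi" and y: "y \<noteq> 1" "\<bar>Arg (1 - y)\<bar> < pi"
  shows "ext_Appell_F1_integral \<Theta> \<alpha> \<beta> \<beta>' \<gamma> x y b d =
     (1 - x) powr (- \<beta>) * (1 - y) powr (- \<beta>')
       * ext_Appell_F1_integral \<Theta> (\<gamma> - \<alpha>) \<beta> \<beta>' \<gamma> (x / (x - 1)) (y / (y - 1)) d b"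
proof -
  let ?f = "\<lambda>\<alpha> x y b d t. of_real t powr (\<alpha> - 1) * (1 - of_real t) powr (\<gamma> - \<alpha> - 1)
        * (1 - x * of_real t) powr (- \<beta>) * (1 - y * of_real t) powr (- \<beta>')
        * \<Theta> (- b / of_real t - d / (1 - of_real t))"
  let ?C = "(1 - x) powr (- \<beta>) * (1 - y) powr (- \<beta>')"
  have "(LINT t:{0<..<1}|lborel. ?f \<alpha> x y b d t) = (LINT t:{0<..<1}|lborel. ?f \<alpha> x y b d (1 - t))"
    by (rule set_integral_reflect_unit_interval)
  also have "\<dots> = (LINT t:{0<..<1}|lborel. ?C * ?f (\<gamma> - \<alpha>) (x / (x - 1)) (y / (y - 1)) d b t)"
  proof (rule set_lebesgue_integral_cong)
    show "\<forall>t. t \<in> {0<..<1} \<longrightarrow>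
        ?f \<alpha> x y b d (1 - t) = ?C * ?f (\<gamma> - \<alpha>) (x / (x - 1)) (y / (y - 1)) d b t"
      using powr_reflect_factor[OF x] powr_reflect_factor[OF y] by (simp add: mult_ac minus_diff_commute)
  qed simp
  also have "\<dots> = ?C * (LINT t:{0<..<1}|lborel. ?f (\<gamma> - \<alpha>) (x / (x - 1)) (y / (y - 1)) d b t)"
    by (rule set_integral_mult_right)
  \<comment> \<open>Euler's beta function is symmetric, so both sides carry the same normalising
    factor.\<close>
  finally show ?thesis
    unfolding ext_Appell_F1_integral_def by (simp add: Beta_commute[of \<alpha>] mult_ac)
qed

theorem theorem3p2:
  fixes \<kappa> :: "nat \<Rightarrow> complex" and \<Theta> :: "complex \<Rightarrow> complex"
    and R M0 :: real and \<omega> :: complex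
    and \<alpha> \<beta> \<beta>' \<gamma> x y b d :: complex
  assumes "admissible_Theta \<kappa> R M0 \<omega> \<Theta>"
    and "Re \<gamma> > Re \<alpha>" and "Re \<alpha> > 0"
    and "min (Re b) (Re d) \<ge> 0"
    and "x \<noteq> 1" and "y \<noteq> 1"
    and "max \<bar>Arg (1 - x)\<bar> \<bar>Arg (1 - y)\<bar> < pi"
    and "set_integrable lborel {0<..<1} (ext_beta_integrand \<Theta> b d \<alpha> (\<gamma> - \<alpha>))"
  shows "ext_Appell_F1 \<Theta> \<alpha> \<beta> \<beta>' \<gamma> x y b d =
     (1 - x) powr (- \<beta>) * (1 - y) powr (- \<beta>')
       * ext_Appell_F1 \<Theta> (\<gamma> - \<alpha>) \<beta> \<beta>' \<gamma> (x / (x - 1)) (y / (y - 1)) d b"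
proof -
  note w = assms(8)
  \<comment> \<open>The right-hand function has first parameter \<open>\<gamma> - \<alpha>\<close>.
    Its second beta parameter is thus \<open>\<gamma> - (\<gamma> - \<alpha>)\<close>, which is
    \<alpha>, the value that the swap produces.\<close>
  have "set_integrable lborel {0<..<1} (ext_beta_integrand \<Theta> d b (\<gamma> - \<alpha>) (\<gamma> - (\<gamma> - \<alpha>)))"
    using set_integrable_ext_beta_integrand_swap[OF w] by simp
  then show ?thesis
    using ext_Appell_F1_integral_transform[of x y] assms(5-7)
    by (simp add: ext_Appell_F1_eq_integral w)
qed

end
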